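(* Let $\Omega=\{a,a+1,\dots,b\}\subset\mathbb{Z}$ with $a<b$ be a finite integer interval, let $\partial\Omega\subseteq\Omega$ be any subset containing $a$ and $b$, put $\Omega^0=\Omega\setminus\partial\Omega$, and let $g:\partial\Omega\to\mathbb{R}$. Consider the D-iteration on $\Omega$ in which the positions of $\partial\Omega$ are catalysts with initial fluid values $F_0(n)=g(n)$ for $n\in\partial\Omega$, and $F_0(n)=0$ for $n\in\Omega^0$, $H_0=0$ on $\Omega$. Then the limit of the history vector $H_k$ of the D-iteration as $k\to\infty$ exists and is equal, at every $n\in\Omega$, to the limit of the iteration of the equation $$T(n)=\tfrac12\big(T(n-1)+T(n+1)\big),\qquad n\in\Omega^0,$$ started from $T(n)=g(n)$ for $n\in\partial\Omega$ and $T(n)=0$ for $n\in\Omega^0$, with the values on $\partial\Omega$ kept fixed.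
   Context: Iteration of the equation (Gauss-Seidel, "collection"): start from $T=g$ on $\partial\Omega$ and $T=0$ on $\Omega^0$. At each step one position $n\in\Omega^0$ is chosen and $T(n)$ is replaced by $\frac12(T(n-1)+T(n+1))$, using the latest values of $T$; all other values are unchanged. The positions of $\Omega^0$ are chosen in a sequence in which each of them occurs infinitely often (for example, cyclically). The limit of the iteration is the pointwise limit of $T$ on $\Omega$. D-iteration ("diffusion"): one maintains a fluid vector $F_k:\Omega\to\mathbb{R}$ and a history vector $H_k:\Omega\to\mathbb{R}$. At each step one position $n\in\Omega$ is chosen and diffused: if $\varphi=F_k(n)$ is its current fluid, then $H(n)$ is increased by $\varphi$, $F(n)$ is set to $0$, and $\frac12\varphi$ is added to the fluid of each of the neighbours $n-1$ and $n+1$ (fluid sent outside $\Omega$ is lost). Catalyst: a position $n$ is a catalyst if it diffuses exactly once, and what it diffuses is its initial fluid value $F_0(n)$; all fluid it receives from neighbours is absorbed (it disappears and is neither added to $H(n)$ nor retransmitted). Thus $H(n)$ is equal to $F_0(n)$ at all times after the single diffusion of $n$. In the D-iteration, each catalyst is diffused exactly once and each position of $\Omega^0$ is chosen for diffusion infinitely often; otherwise the order of the diffusions is arbitrary and independent of the values of $F$ and $H$. The limit of the D-iteration is the pointwise limit of $H_k$. *)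

theory Defs
  imports Complex_Main
begin

text \<open>
  A vector on \<open>\<Omega>\<close> is a function \<open>int \<Rightarrow> real\<close> of which only the values on \<open>\<Omega>\<close> matter.

  A sequence of positions is a function \<open>nat \<Rightarrow> int option\<close>. The value \<open>None\<close> marks the end of a
  finite sequence. Finite sequences are needed only when the interior is empty; otherwise
  ``infinitely often'' forces every entry to be \<open>Some\<close>.
\<close>

definition position_sequence :: "int set \<Rightarrow> (nat \<Rightarrow> int option) \<Rightarrow> bool" where
  "position_sequence S s \<longleftrightarrow>
     (\<forall>k n. s k = Some n \<longrightarrow> n \<in> S) \<and>
     (\<forall>j k. j \<le> k \<longrightarrow> s j = None \<longrightarrow> s k = None)"

definition infinitely_often :: "(nat \<Rightarrow> int option) \<Rightarrow> int \<Rightarrow> bool" where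
  "infinitely_often s n \<longleftrightarrow> infinite {k. s k = Some n}"

definition exactly_once :: "(nat \<Rightarrow> int option) \<Rightarrow> int \<Rightarrow> bool" where
  "exactly_once s n \<longleftrightarrow> (\<exists>!k. s k = Some n)"

definition boundary_vector :: "int set \<Rightarrow> (int \<Rightarrow> real) \<Rightarrow> int \<Rightarrow> real" where
  "boundary_vector B g n = (if n \<in> B then g n else 0)"

definition collection_sequence :: "int set \<Rightarrow> int set \<Rightarrow> (nat \<Rightarrow> int option) \<Rightarrow> bool" where
  "collection_sequence \<Omega> B s \<longleftrightarrow>
     position_sequence (\<Omega> - B) s \<and> (\<forall>n \<in> \<Omega> - B. infinitely_often s n)"

definition collect :: "int \<Rightarrow> (int \<Rightarrow> real) \<Rightarrow> (int \<Rightarrow> real)" where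
  "collect n T = T(n := (T (n - 1) + T (n + 1)) / 2)"

primrec collection :: "(int \<Rightarrow> real) \<Rightarrow> (nat \<Rightarrow> int option) \<Rightarrow> nat \<Rightarrow> int \<Rightarrow> real" where
  "collection T0 s 0 = T0"
| "collection T0 s (Suc k) =
     (case s k of None \<Rightarrow> collection T0 s k | Some n \<Rightarrow> collect n (collection T0 s k))"

definition diffusion_sequence :: "int set \<Rightarrow> int set \<Rightarrow> (nat \<Rightarrow> int option) \<Rightarrow> bool" where
  "diffusion_sequence \<Omega> C s \<longleftrightarrow>
     position_sequence \<Omega> s \<and> (\<forall>n \<in> C. exactly_once s n) \<and> (\<forall>n \<in> \<Omega> - C. infinitely_often s n)"

text \<open>
  A state is a pair of the fluid vector \<open>F\<close> and the history vector \<open>H\<close>. Fluid reaching a catalyst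
  disappears, so a catalyst keeps its initial fluid until it is chosen and has none afterwards.
  That it diffuses only once is a property of the sequence of positions.
\<close>

definition diffuse :: "int set \<Rightarrow> int set \<Rightarrow> int \<Rightarrow>
    (int \<Rightarrow> real) \<times> (int \<Rightarrow> real) \<Rightarrow> (int \<Rightarrow> real) \<times> (int \<Rightarrow> real)" where
  "diffuse \<Omega> C n = (\<lambda>(F, H).
     ((\<lambda>m. if m = n then 0
           else if m \<in> {n - 1, n + 1} \<and> m \<in> \<Omega> \<and> m \<notin> C then F m + F n / 2
           else F m),
      H(n := H n + F n)))"

primrec d_iteration :: "int set \<Rightarrow> int set \<Rightarrow> (int \<Rightarrow> real) \<Rightarrow> (nat \<Rightarrow> int option) \<Rightarrow>
    nat \<Rightarrow> (int \<Rightarrow> real) \<times> (int \<Rightarrow> real)" where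
  "d_iteration \<Omega> C F0 s 0 = (F0, \<lambda>_. 0)"
| "d_iteration \<Omega> C F0 s (Suc k) =
     (case s k of None \<Rightarrow> d_iteration \<Omega> C F0 s k
                | Some n \<Rightarrow> diffuse \<Omega> C n (d_iteration \<Omega> C F0 s k))"

definition history :: "int set \<Rightarrow> int set \<Rightarrow> (int \<Rightarrow> real) \<Rightarrow> (nat \<Rightarrow> int option) \<Rightarrow>
    nat \<Rightarrow> int \<Rightarrow> real" where
  "history \<Omega> C F0 s k = snd (d_iteration \<Omega> C F0 s k)"

end

theory Submission
  imports Defs
begin

text \<open>
  In the D-iteration an interior position always satisfies
  \<open>H n + F n = (H (n - 1) + H (n + 1)) / 2\<close> (lemma \<open>history_plus_fluid_interior\<close>): whatever it has
  received is half of what its neighbours have diffused, and it holds exactly the part that it has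
  not yet diffused. Hence diffusing \<open>n\<close> replaces \<open>H n\<close> by the mean of \<open>H\<close> at the neighbours: the
  history vector itself performs a Gauss-Seidel iteration, except that the value of a catalyst jumps
  once from 0 to \<open>g\<close>. From the moment at which all catalysts have been diffused, both iterations of
  the theorem are Gauss-Seidel iterations with the same boundary values, and only their orders and
  their starting vectors differ.

  It remains to compare any two such processes \<open>X\<close> and \<open>Y\<close>, run in unrelated orders. The weight
  \<open>q n = 1 + (n - a) * (b - n)\<close> is strictly concave: its mean over the neighbours of \<open>n\<close> is
  \<open>q n - 1\<close>, which is at most \<open>\<theta> * q n\<close> for a constant \<open>\<theta> < 1\<close>. Suppose that
  \<open>\<bar>X k n - Y j n\<bar> \<le> D * q n\<close> on \<open>\<Omega>\<close> for all late \<open>k\<close> and \<open>j\<close>. Once each interior position has been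
  updated again in both processes, its two values are means of late neighbouring values, so the
  bound holds with \<open>\<theta> * D\<close> in place of \<open>D\<close>. Since \<open>k\<close> and \<open>j\<close> are independent, this also applies to
  \<open>Y = X\<close>. It therefore gives convergence (the Cauchy property) as well as equality of the limits,
  and no solution of the boundary value problem has to be constructed.
\<close>

section \<open>Averaging processes on an interval\<close>

text \<open>
  What the comparison uses of an iteration: no reference to the order of the updates, only that
  every late value at an interior position is a mean of neighbouring values which are themselves
  late. The third clause has this form because \<open>X k n\<close> was set at the last update of \<open>n\<close> before
  \<open>k\<close>, and that update comes after any given time \<open>K\<close> if \<open>k\<close> is large.
\<close>

definition averaging_process ::
    "int set \<Rightarrow> int set \<Rightarrow> (int \<Rightarrow> real) \<Rightarrow> (nat \<Rightarrow> int \<Rightarrow> real) \<Rightarrow> bool" where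
  "averaging_process \<Omega> B g X \<longleftrightarrow>
     (\<exists>M. \<forall>k. \<forall>n\<in>\<Omega>. \<bar>X k n\<bar> \<le> M) \<and>
     (\<forall>n\<in>B. \<forall>\<^sub>F k in sequentially. X k n = g n) \<and>
     (\<forall>n\<in>\<Omega> - B. \<forall>K. \<forall>\<^sub>F k in sequentially. \<exists>i\<ge>K. X k n = (X i (n - 1) + X i (n + 1)) / 2)"

lemma interior_neighbours:
  fixes a b n :: int
  assumes "n \<in> {a..b} - B" "a \<in> B" "b \<in> B"
  shows "n - 1 \<in> {a..b}" "n + 1 \<in> {a..b}"
proof -
  have "n \<noteq> a" "n \<noteq> b" using assms by auto
  then show "n - 1 \<in> {a..b}" "n + 1 \<in> {a..b}" using assms(1) by auto
qed

text \<open>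
  Iterations that update an interior position infinitely often, always by the mean rule, are
  averaging processes. Averaging cannot leave \<open>[-M, M]\<close>, so a bound on the values on \<open>B\<close> and on the
  starting vector is enough.
\<close>

lemma averaging_processI:
  fixes a b :: int
  assumes ends: "a \<in> B" "b \<in> B"
    and start: "\<And>n. n \<in> {a..b} - B \<Longrightarrow> \<bar>X 0 n\<bar> \<le> M"
    and boundary_bound: "\<And>k n. n \<in> B \<Longrightarrow> \<bar>X k n\<bar> \<le> M"
    and boundary: "\<And>n. n \<in> B \<Longrightarrow> \<forall>\<^sub>F k in sequentially. X k n = g n"
    and update: "\<And>k n. n \<in> {a..b} - B \<Longrightarrow> s k = Some n \<Longrightarrow>
                   X (Suc k) n = (X k (n - 1) + X k (n + 1)) / 2"
    and keep: "\<And>k n. n \<in> {a..b} - B \<Longrightarrow> s k \<noteq> Some n \<Longrightarrow> X (Suc k) n = X k n"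
    and chosen: "\<And>n. n \<in> {a..b} - B \<Longrightarrow> infinitely_often s n"
  shows "averaging_process {a..b} B g X"
  unfolding averaging_process_def
proof (intro conjI ballI allI)
  have "\<bar>X k n\<bar> \<le> M" if "n \<in> {a..b}" for k n
    using that
  proof (induction k arbitrary: n)
    case 0
    then show ?case using start boundary_bound by (cases "n \<in> B") auto
  next
    case (Suc k)
    show ?case
    proof (cases "n \<in> B")
      case True
      then show ?thesis by (rule boundary_bound)
    next
      case False
      with Suc.prems have n: "n \<in> {a..b} - B" by simp
      have "\<bar>X k n\<bar> \<le> M" "\<bar>X k (n - 1)\<bar> \<le> M" "\<bar>X k (n + 1)\<bar> \<le> M"
        using Suc.IH Suc.prems interior_neighbours[OF n ends] by blast+
      then show ?thesis
        using update[OF n, of k] keep[OF n, of k] by (cases "s k = Some n") auto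
    qed
  qed
  then show "\<exists>M. \<forall>k. \<forall>n\<in>{a..b}. \<bar>X k n\<bar> \<le> M" by blast
next
  fix n assume "n \<in> B"
  then show "\<forall>\<^sub>F k in sequentially. X k n = g n" by (rule boundary)
next
  fix n K assume n: "n \<in> {a..b} - B"
  obtain i where i: "i \<ge> K" "s i = Some n"
    using chosen[OF n] unfolding infinitely_often_def finite_nat_set_iff_bounded by (auto simp: not_less)
  have "\<exists>i\<ge>K. X k n = (X i (n - 1) + X i (n + 1)) / 2" if "k \<ge> Suc i" for k
    using that
  proof (induction k rule: dec_induct)
    case base
    then show ?case using update[OF n i(2)] i(1) by blast
  next
    case (step k)
    have "K \<le> k" using i(1) step.hyps by simp
    then show ?case
      using update[OF n, of k] keep[OF n, of k] step.IH by (cases "s k = Some n") auto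
  qed
  then show "\<forall>\<^sub>F k in sequentially. \<exists>i\<ge>K. X k n = (X i (n - 1) + X i (n + 1)) / 2"
    unfolding eventually_sequentially by blast
qed

section \<open>Comparison of two averaging processes\<close>

text \<open>
  The quadratic term has second difference \<open>-2\<close>, so taking the mean over the neighbours lowers the
  weight by 1; the summand 1 keeps the weight positive at the endpoints.
\<close>

definition weight :: "int \<Rightarrow> int \<Rightarrow> int \<Rightarrow> real" where
  "weight a b n = 1 + real_of_int ((n - a) * (b - n))"

text \<open>
  The weight is at most \<open>Q = 1 + (b - a)\<^sup>2\<close>, so lowering it by 1 removes at least the fraction
  \<open>1 / Q\<close> of it.
\<close>

definition contraction :: "int \<Rightarrow> int \<Rightarrow> real" where
  "contraction a b = 1 - 1 / (1 + (real_of_int (b - a))\<^sup>2)"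

lemma weight_ge_1: "n \<in> {a..b} \<Longrightarrow> weight a b n \<ge> 1"
  unfolding weight_def by auto

lemma weight_le:
  assumes "n \<in> {a..b}"
  shows "weight a b n \<le> 1 + (real_of_int (b - a))\<^sup>2"
proof -
  have "(n - a) * (b - n) \<le> (b - a) * (b - a)"
    using assms by (intro mult_mono) auto
  then have "real_of_int ((n - a) * (b - n)) \<le> real_of_int ((b - a) * (b - a))"
    by (simp only: of_int_le_iff)
  then show ?thesis unfolding weight_def power2_eq_square by simp
qed

lemma contraction_bounds: "0 \<le> contraction a b" "contraction a b < 1"
proof -
  have "(1::real) \<le> 1 + (real_of_int (b - a))\<^sup>2" by simp
  then show "0 \<le> contraction a b" "contraction a b < 1"
    unfolding contraction_def by (simp_all add: add_pos_nonneg)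
qed

lemma weight_mean_le:
  assumes "n \<in> {a..b}"
  shows "(weight a b (n - 1) + weight a b (n + 1)) / 2 \<le> contraction a b * weight a b n"
proof -
  define Q where "Q = 1 + (real_of_int (b - a))\<^sup>2"
  have "Q \<ge> 1" and "weight a b n \<le> Q"
    using weight_le[OF assms] by (auto simp: Q_def)
  then have "weight a b n / Q \<le> 1" by simp
  moreover have "contraction a b * weight a b n = weight a b n - weight a b n / Q"
    unfolding contraction_def Q_def[symmetric] by (simp add: algebra_simps)
  moreover have "(weight a b (n - 1) + weight a b (n + 1)) / 2 = weight a b n - 1"
    unfolding weight_def by (simp add: field_simps)
  ultimately show ?thesis by linarith
qed

text \<open>
  One more update of every interior position in both processes gains a factor \<open>\<theta>\<close>; on \<open>B\<close> the
  difference is eventually 0. The times \<open>k\<close> and \<open>j\<close> are not coupled, because the two processes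
  choose their positions independently.
\<close>

lemma averaging_processes_contract:
  fixes a b :: int
  assumes X: "averaging_process {a..b} B g X" and Y: "averaging_process {a..b} B g Y"
    and ends: "a \<in> B" "b \<in> B"
    and close: "\<forall>k\<ge>K. \<forall>j\<ge>K. \<forall>n\<in>{a..b}. \<bar>X k n - Y j n\<bar> \<le> D * weight a b n"
    and D: "0 \<le> D"
  shows "\<exists>K'. \<forall>k\<ge>K'. \<forall>j\<ge>K'. \<forall>n\<in>{a..b}.
           \<bar>X k n - Y j n\<bar> \<le> (contraction a b * D) * weight a b n"
proof -
  let ?late = "\<lambda>Z k n. if n \<in> B then Z k n = g n
                       else \<exists>i\<ge>K. Z k n = (Z i (n - 1) + Z i (n + 1)) / 2"
  have "\<forall>\<^sub>F k in sequentially. \<forall>n\<in>{a..b}. ?late Z k n"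
    if "averaging_process {a..b} B g Z" for Z
  proof (rule eventually_ball_finite)
    show "\<forall>n\<in>{a..b}. \<forall>\<^sub>F k in sequentially. ?late Z k n"
    proof
      fix n assume "n \<in> {a..b}"
      then show "\<forall>\<^sub>F k in sequentially. ?late Z k n"
        using that unfolding averaging_process_def by (cases "n \<in> B") auto
    qed
  qed simp
  from this[OF X] this[OF Y]
  obtain K1 K2 where K1: "\<forall>k\<ge>K1. \<forall>n\<in>{a..b}. ?late X k n"
    and K2: "\<forall>j\<ge>K2. \<forall>n\<in>{a..b}. ?late Y j n"
    unfolding eventually_sequentially by blast
  have "\<bar>X k n - Y j n\<bar> \<le> (contraction a b * D) * weight a b n"
    if "k \<ge> max K1 K2" "j \<ge> max K1 K2" and n: "n \<in> {a..b}" for k j n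
  proof -
    have "K1 \<le> k" "K2 \<le> j" using that by auto
    with K1 K2 n have late: "?late X k n" "?late Y j n" by blast+
    show ?thesis
    proof (cases "n \<in> B")
      case True
      then show ?thesis
        using late D contraction_bounds(1)[of a b] weight_ge_1[OF n] by simp
    next
      case False
      then obtain i l where i: "i \<ge> K" "X k n = (X i (n - 1) + X i (n + 1)) / 2"
        and l: "l \<ge> K" "Y j n = (Y l (n - 1) + Y l (n + 1)) / 2"
        using late unfolding if_not_P[OF False] by blast
      have nb: "n - 1 \<in> {a..b}" "n + 1 \<in> {a..b}"
        using interior_neighbours[of n a b B] n False ends by auto
      have "\<bar>X i (n - 1) - Y l (n - 1)\<bar> \<le> D * weight a b (n - 1)"
        "\<bar>X i (n + 1) - Y l (n + 1)\<bar> \<le> D * weight a b (n + 1)"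
        using close i(1) l(1) nb by blast+
      then have "\<bar>X k n - Y j n\<bar> \<le> D * ((weight a b (n - 1) + weight a b (n + 1)) / 2)"
        unfolding i(2) l(2) by (simp add: field_simps)
      also have "\<dots> \<le> D * (contraction a b * weight a b n)"
        using weight_mean_le[OF n] D by (rule mult_left_mono)
      finally show ?thesis by (simp add: mult_ac)
    qed
  qed
  then show ?thesis by blast
qed

lemma averaging_processes_geometrically_close:
  fixes a b :: int
  assumes X: "averaging_process {a..b} B g X" and Y: "averaging_process {a..b} B g Y"
    and ends: "a \<in> B" "b \<in> B"
  shows "\<exists>D\<ge>0. \<forall>r. \<exists>K. \<forall>k\<ge>K. \<forall>j\<ge>K. \<forall>n\<in>{a..b}.
           \<bar>X k n - Y j n\<bar> \<le> (contraction a b ^ r * D) * weight a b n"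
proof -
  obtain M1 M2 where M1: "\<And>k n. n \<in> {a..b} \<Longrightarrow> \<bar>X k n\<bar> \<le> M1"
    and M2: "\<And>k n. n \<in> {a..b} \<Longrightarrow> \<bar>Y k n\<bar> \<le> M2"
    using X Y unfolding averaging_process_def by meson
  define D where "D = \<bar>M1\<bar> + \<bar>M2\<bar>"
  have "D \<ge> 0" by (simp add: D_def)
  have "\<exists>K. \<forall>k\<ge>K. \<forall>j\<ge>K. \<forall>n\<in>{a..b}.
          \<bar>X k n - Y j n\<bar> \<le> (contraction a b ^ r * D) * weight a b n" for r
  proof (induction r)
    case 0
    have "\<bar>X k n - Y j n\<bar> \<le> D * weight a b n" if n: "n \<in> {a..b}" for k j n
    proof -
      have "\<bar>X k n - Y j n\<bar> \<le> D * 1"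
        using M1[OF n, of k] M2[OF n, of j] unfolding D_def mult_1_right by linarith
      also have "\<dots> \<le> D * weight a b n"
        using weight_ge_1[OF n] \<open>D \<ge> 0\<close> by (rule mult_left_mono)
      finally show ?thesis .
    qed
    then show ?case by simp
  next
    case (Suc r)
    then obtain K where "\<forall>k\<ge>K. \<forall>j\<ge>K. \<forall>n\<in>{a..b}.
        \<bar>X k n - Y j n\<bar> \<le> (contraction a b ^ r * D) * weight a b n" by blast
    from averaging_processes_contract[OF X Y ends this] show ?case
      using \<open>D \<ge> 0\<close> contraction_bounds(1)[of a b] by (simp add: mult_ac)
  qed
  then show ?thesis using \<open>D \<ge> 0\<close> by blast
qed

lemma averaging_processes_close:
  fixes a b n :: int
  assumes X: "averaging_process {a..b} B g X" and Y: "averaging_process {a..b} B g Y"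
    and ends: "a \<in> B" "b \<in> B" and n: "n \<in> {a..b}" and e: "(e::real) > 0"
  shows "\<exists>K. \<forall>k\<ge>K. \<forall>j\<ge>K. \<bar>X k n - Y j n\<bar> < e"
proof -
  obtain D where D: "\<And>r. \<exists>K. \<forall>k\<ge>K. \<forall>j\<ge>K. \<forall>n\<in>{a..b}.
      \<bar>X k n - Y j n\<bar> \<le> (contraction a b ^ r * D) * weight a b n"
    using averaging_processes_geometrically_close[OF X Y ends] by blast
  have "(\<lambda>r. contraction a b ^ r) \<longlonglongrightarrow> 0"
    by (rule LIMSEQ_realpow_zero[OF contraction_bounds])
  then have "(\<lambda>r. contraction a b ^ r * D * weight a b n) \<longlonglongrightarrow> 0"
    by (intro tendsto_mult_left_zero)
  then have "\<forall>\<^sub>F r in sequentially. contraction a b ^ r * D * weight a b n < e"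
    using e by (rule order_tendstoD(2))
  then obtain r where "contraction a b ^ r * D * weight a b n < e"
    unfolding eventually_sequentially by blast
  with D[of r] n show ?thesis by (meson le_less_trans)
qed

text \<open>
  Comparing \<open>X\<close> with itself shows that it is a Cauchy sequence; comparing \<open>X\<close> with \<open>Y\<close> carries its
  limit over to \<open>Y\<close>.
\<close>

lemma averaging_processes_common_limit:
  fixes a b n :: int
  assumes X: "averaging_process {a..b} B g X" and Y: "averaging_process {a..b} B g Y"
    and ends: "a \<in> B" "b \<in> B" and n: "n \<in> {a..b}"
  shows "\<exists>L. (\<lambda>k. X k n) \<longlonglongrightarrow> L \<and> (\<lambda>k. Y k n) \<longlonglongrightarrow> L"
proof -
  have "Cauchy (\<lambda>k. X k n)"
    using averaging_processes_close[OF X X ends n] unfolding Cauchy_def dist_real_def by blast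
  then obtain L where L: "(\<lambda>k. X k n) \<longlonglongrightarrow> L"
    using Cauchy_convergent_iff convergent_def by blast
  have "(\<lambda>k. X k n - Y k n) \<longlonglongrightarrow> 0"
    unfolding LIMSEQ_iff using averaging_processes_close[OF X Y ends n] by fastforce
  from tendsto_diff[OF L this] have "(\<lambda>k. Y k n) \<longlonglongrightarrow> L" by simp
  with L show ?thesis by blast
qed

section \<open>The collection is an averaging process\<close>

lemma finite_interval_bound:
  fixes g :: "int \<Rightarrow> real"
  assumes "B \<subseteq> {a..b}"
  obtains M where "M \<ge> 0" "\<And>n. n \<in> B \<Longrightarrow> \<bar>g n\<bar> \<le> M"
proof
  have "finite B" using assms finite_subset by blast
  then show "\<bar>g n\<bar> \<le> (\<Sum>m\<in>B. \<bar>g m\<bar>)" if "n \<in> B" for n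
    using that by (intro member_le_sum) auto
qed (simp add: sum_nonneg)

lemma collection_boundary:
  assumes "position_sequence (\<Omega> - B) s" "n \<in> B"
  shows "collection T0 s k n = T0 n"
proof (induction k)
  case (Suc k)
  then show ?case
    using assms unfolding position_sequence_def by (auto simp: collect_def split: option.split)
qed simp

lemma collection_averaging_process:
  assumes ends: "a \<in> B" "b \<in> B" and sub: "B \<subseteq> {a..b}"
    and c: "collection_sequence {a..b} B c"
  shows "averaging_process {a..b} B g (collection (boundary_vector B g) c)"
proof -
  obtain M where M: "M \<ge> 0" "\<And>n. n \<in> B \<Longrightarrow> \<bar>g n\<bar> \<le> M"
    using finite_interval_bound[OF sub] by blast
  have fixed: "collection (boundary_vector B g) c k n = g n" if "n \<in> B" for k n
    using collection_boundary[of "{a..b}" B c n] that c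
    by (simp add: collection_sequence_def boundary_vector_def)
  show ?thesis
  proof (rule averaging_processI[where M = M and s = c])
    show "infinitely_often c n" if "n \<in> {a..b} - B" for n
      using c that by (simp add: collection_sequence_def)
  qed (auto simp: ends M fixed collect_def boundary_vector_def split: option.split)
qed

section \<open>The history vector is an averaging process\<close>

abbreviation fluid where
  "fluid \<Omega> C F0 s k \<equiv> fst (d_iteration \<Omega> C F0 s k)"

lemma history_Suc:
  "history \<Omega> C F0 s (Suc k) n =
     history \<Omega> C F0 s k n + (if s k = Some n then fluid \<Omega> C F0 s k n else 0)"
  by (auto simp: history_def diffuse_def split: option.split prod.split)

lemma fluid_Suc:
  "fluid \<Omega> C F0 s (Suc k) n =
     (case s k of None \<Rightarrow> fluid \<Omega> C F0 s k n
      | Some m \<Rightarrow> if n = m then 0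
                  else if n \<in> {m - 1, m + 1} \<and> n \<in> \<Omega> \<and> n \<notin> C
                    then fluid \<Omega> C F0 s k n + fluid \<Omega> C F0 s k m / 2
                  else fluid \<Omega> C F0 s k n)"
  by (auto simp: diffuse_def split: option.split prod.split)

text \<open>
  Conservation of fluid: what \<open>n\<close> has diffused together with what it still holds is what it has
  received, namely half of everything that each neighbour has diffused so far.
\<close>

lemma history_plus_fluid_interior:
  assumes "n \<in> \<Omega> - C" "F0 n = 0"
  shows "history \<Omega> C F0 s k n + fluid \<Omega> C F0 s k n =
           (history \<Omega> C F0 s k (n - 1) + history \<Omega> C F0 s k (n + 1)) / 2"
proof (induction k)
  case 0
  then show ?case using assms by (simp add: history_def)
next
  case (Suc k)
  then show ?case
    using assms
    by (auto simp del: d_iteration.simps simp add: history_Suc fluid_Suc field_simps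
        split: option.split)
qed

text \<open>
  A catalyst absorbs what it receives, so it holds its initial fluid until it is chosen, and
  from then on it has none left that could change its history.
\<close>

lemma catalyst_state:
  assumes "n \<in> C"
  shows "history \<Omega> C F0 s k n = (if \<exists>j<k. s j = Some n then F0 n else 0) \<and>
         fluid \<Omega> C F0 s k n = (if \<exists>j<k. s j = Some n then 0 else F0 n)"
proof (induction k)
  case 0
  then show ?case by (simp add: history_def)
next
  case (Suc k)
  have "(\<exists>j<Suc k. s j = Some n) \<longleftrightarrow> s k = Some n \<or> (\<exists>j<k. s j = Some n)"
    by (auto simp: less_Suc_eq)
  with Suc assms show ?case
    by (auto simp del: d_iteration.simps simp add: history_Suc fluid_Suc split: option.split)
qed

lemma history_averaging_process:
  assumes ends: "a \<in> B" "b \<in> B" and sub: "B \<subseteq> {a..b}"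
    and d: "diffusion_sequence {a..b} B d"
  shows "averaging_process {a..b} B g (history {a..b} B (boundary_vector B g) d)"
    (is "averaging_process _ _ _ ?H")
proof -
  obtain M where M: "M \<ge> 0" "\<And>n. n \<in> B \<Longrightarrow> \<bar>g n\<bar> \<le> M"
    using finite_interval_bound[OF sub] by blast
  have catalyst: "?H k n = (if \<exists>j<k. d j = Some n then g n else 0)" if "n \<in> B" for k n
    using catalyst_state[OF that, of "{a..b}" "boundary_vector B g" d k] that
    by (simp only: boundary_vector_def if_True)
  show ?thesis
  proof (rule averaging_processI[where M = M and s = d])
    fix n assume "n \<in> B"
    then obtain j where "d j = Some n"
      using d unfolding diffusion_sequence_def exactly_once_def by blast
    then have "?H k n = g n" if "k \<ge> Suc j" for k
      using catalyst[OF \<open>n \<in> B\<close>, of k] that by auto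
    then show "\<forall>\<^sub>F k in sequentially. ?H k n = g n"
      unfolding eventually_sequentially by blast
  next
    fix k n assume n: "n \<in> {a..b} - B" and "d k = Some n"
    then show "?H (Suc k) n = (?H k (n - 1) + ?H k (n + 1)) / 2"
      using history_plus_fluid_interior[OF n, of "boundary_vector B g" d k]
      by (simp add: history_Suc boundary_vector_def)
  next
    show "infinitely_often d n" if "n \<in> {a..b} - B" for n
      using d that by (simp add: diffusion_sequence_def)
  next
    show "\<bar>?H 0 n\<bar> \<le> M" for n
      using M(1) by (simp add: history_def)
  qed (auto simp: ends M catalyst history_Suc)
qed

theorem theorem1:
  fixes a b :: int and \<Omega> B :: "int set" and g :: "int \<Rightarrow> real"
    and d c :: "nat \<Rightarrow> int option"
  assumes "a < b" and "\<Omega> = {a..b}"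
    and "B \<subseteq> \<Omega>" and "a \<in> B" and "b \<in> B"
    and "diffusion_sequence \<Omega> B d"
    and "collection_sequence \<Omega> B c"
  shows "\<forall>n \<in> \<Omega>. \<exists>L.
           (\<lambda>k. history \<Omega> B (boundary_vector B g) d k n) \<longlonglongrightarrow> L \<and>
           (\<lambda>k. collection (boundary_vector B g) c k n) \<longlonglongrightarrow> L"
  using averaging_processes_common_limit[OF history_averaging_process collection_averaging_process]
    assms
  by blast

end
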